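(* Let $\alpha>0$ and $\beta>0$ be fixed real numbers. Let $X$ be an absolutely continuous real random variable with cumulative distribution function $F$ and probability density function $f$, such that $E(X)$ exists, $\inf\{x: F(x)>0\}=0$, $\sup\{x: F(x)<1\}=1$, and $f$ is differentiable on $(0,1)$. For $x\in(0,1)$ put $\tau(x)=\frac{f(x)}{F(x)}$ and $$g(x)=\frac{\alpha^{1/\beta}}{\alpha\beta}\exp\left(\frac{\alpha}{x^{\beta}}\right)x^{1+\beta}\,\Gamma\left(1-\frac1\beta;\frac{\alpha}{x^{\beta}}\right).$$ Then $$E(X\mid X\le x)=g(x)\,\tau(x)\quad\text{for all }x\in(0,1)$$ if and only if $$f(x)=\frac{\alpha\beta\exp\left[-\alpha\left(1/x^{\beta}-1\right)\right]}{x^{1+\beta}}\quad\text{for all }x\in(0,1).$$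
   Context: For real $s$ and $x>0$, $\Gamma(s;x)=\int_x^\infty t^{s-1}e^{-t}\,dt$ denotes the upper incomplete gamma function. The conditional expectation is $E(X\mid X\le x)=\frac{1}{F(x)}\int_{0}^{x}t f(t)\,dt$. The density $f(x)=\alpha\beta\, x^{-1-\beta}\exp[-\alpha(x^{-\beta}-1)]$ on $(0,1)$ is that of the unit-Gompertz distribution with parameters $\alpha,\beta$, whose cumulative distribution function on $(0,1)$ is $\exp[-\alpha(x^{-\beta}-1)]$. *)

theory Defs
  imports "HOL-Probability.Probability"
begin

definition upper_inc_Gamma :: "real \<Rightarrow> real \<Rightarrow> real" where
  "upper_inc_Gamma s x = (LBINT t:{x..}. t powr (s - 1) * exp (- t))"

text \<open>\<open>E(X | X \<le> x)\<close> for a random variable with distribution function \<open>F\<close> and density \<open>f\<close>.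
  The integral starts at 0, so this is the conditional mean for random variables that are
  almost surely nonnegative; see \<open>cond_mean_le_eq\<close> below.\<close>

definition cond_mean_le :: "(real \<Rightarrow> real) \<Rightarrow> (real \<Rightarrow> real) \<Rightarrow> real \<Rightarrow> real" where
  "cond_mean_le F f x = 1 / F x * (LBINT t:{0..x}. t * f t)"

lemma (in prob_space) cond_mean_le_eq:
  fixes X :: "'a \<Rightarrow> real" and f :: "real \<Rightarrow> real"
  assumes dist: "distributed M lborel X (\<lambda>x. ennreal (f x))"
    and nonneg: "\<And>x. 0 \<le> f x"
    and pos: "AE \<omega> in M. 0 \<le> X \<omega>"
  shows "cond_mean_le (cdf (distr M borel X)) f x =
    (\<integral>\<omega>. X \<omega> * indicator {\<omega> \<in> space M. X \<omega> \<le> x} \<omega> \<partial>M) / prob {\<omega> \<in> space M. X \<omega> \<le> x}"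
proof -
  have X [measurable]: "random_variable borel X"
    using distributed_measurable[OF dist] by simp
  have "(\<integral>\<omega>. X \<omega> * indicator {\<omega> \<in> space M. X \<omega> \<le> x} \<omega> \<partial>M) =
      (\<integral>\<omega>. indicator {0..x} (X \<omega>) * X \<omega> \<partial>M)"
    using pos by (intro integral_cong_AE) (auto simp: indicator_def)
  also have "\<dots> = (\<integral>t. f t * (indicator {0..x} t * t) \<partial>lborel)"
    using nonneg by (intro distributed_integral[OF dist, symmetric]) auto
  also have "\<dots> = (LBINT t:{0..x}. t * f t)"
    unfolding set_lebesgue_integral_def by (simp add: ac_simps)
  finally have "(\<integral>\<omega>. X \<omega> * indicator {\<omega> \<in> space M. X \<omega> \<le> x} \<omega> \<partial>M) =
      (LBINT t:{0..x}. t * f t)" .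
  moreover have "cdf (distr M borel X) x = prob {\<omega> \<in> space M. X \<omega> \<le> x}"
    unfolding cdf_def by (subst measure_distr) (auto intro!: arg_cong[where f = prob])
  ultimately show ?thesis
    by (simp add: cond_mean_le_def)
qed

end

theory Submission
  imports Defs "HOL-Real_Asymp.Real_Asymp"
begin

text \<open>Write \<open>p\<close> for the unit-Gompertz density, \<open>P\<close> for its distribution function and
  \<open>K x\<close> for its partial first moment over \<open>(0, x]\<close>. The substitution \<open>u = \<alpha> / t powr \<beta>\<close> expresses \<open>K\<close> by
  the incomplete gamma function, and \<open>g = K / p\<close>. With \<open>m x = \<integral>\<^sub>0\<^sup>x t f t dt\<close> the identity for
  the conditional mean therefore reads \<open>m p = K f\<close>. As \<open>m' = x f\<close> and \<open>K' = x p\<close>, this says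
  that \<open>m / K\<close> has derivative 0, so \<open>m = c K\<close> and \<open>f = c p\<close>; comparing the limits of \<open>F - c P\<close>
  at 0 and 1 forces \<open>c = 1\<close>. Conversely, \<open>f = p\<close> gives \<open>(m - K)' = 0\<close>, and both \<open>m\<close> and
  \<open>K\<close> vanish at 0.\<close>

section \<open>Integrals as functions of the upper limit\<close>

text \<open>Continuity is known only on an open interval, so the fundamental theorem of calculus is
  applied on a compact interval \<open>{c..d}\<close> around \<open>x\<close> inside it; the
  integral over \<open>{..<c}\<close> is an additive constant. This serves the distribution
  function, the partial moment and the incomplete gamma function alike.\<close>

lemma set_integral_atMost_has_real_derivative:
  fixes k :: "real \<Rightarrow> real"
  assumes int: "integrable lborel k"
    and cont: "continuous_on {a<..<b} k" and x: "x \<in> {a<..<b}"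
  shows "((\<lambda>y. LBINT t:{..y}. k t) has_real_derivative k x) (at x)"
proof -
  obtain c where c: "a < c" "c < x" using x dense[of a x] by auto
  obtain d where d: "x < d" "d < b" using x dense[of x b] by auto
  have si: "set_integrable lborel S k" if "S \<in> sets borel" for S
    using that int unfolding set_integrable_def
    by (intro integrable_mult_indicator) auto
  have split: "(LBINT t:{..<c}. k t) + integral {c..y} k = (LBINT t:{..y}. k t)"
    if "y \<in> {c..d}" for y
  proof -
    have "{..y} = {..<c} \<union> {c..y}" using that by auto
    then have "(LBINT t:{..y}. k t) = (LBINT t:{..<c}. k t) + (LBINT t:{c..y}. k t)"
      by (simp only:) (intro set_integral_Un si, auto)
    then show ?thesis
      using set_borel_integral_eq_integral(2)[OF si[of "{c..y}"]] by simp
  qed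
  have "((\<lambda>y. integral {c..y} k) has_real_derivative k x) (at x within {c..d})"
    using c d x by (intro integral_has_real_derivative continuous_on_subset[OF cont]) auto
  then have "((\<lambda>y. integral {c..y} k) has_real_derivative k x) (at x)"
    using c d by (simp add: at_within_Icc_at)
  then have "((\<lambda>y. (LBINT t:{..<c}. k t) + integral {c..y} k) has_real_derivative k x) (at x)"
    by (auto intro!: derivative_eq_intros)
  then show ?thesis
    by (rule has_field_derivative_transform_within_open[where S="{c<..<d}"])
       (use c d split in auto)
qed

section \<open>The upper incomplete gamma function\<close>

text \<open>The parameter of interest, 1 - 1 / \<beta>, may be nonpositive, where the full gamma
  integral diverges at 0. On \<open>{a..}\<close> the exponent can be raised to
  \<open>r = max s 1\<close>: as \<open>s - r\<close> is nonpositive, \<open>t powr (s - r)\<close>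
  is at most \<open>a powr (s - r)\<close>, and the Gamma integrand for \<open>r\<close> dominates
  up to this constant.\<close>

lemma set_integrable_powr_exp_minus:
  fixes s a :: real
  assumes a: "0 < a"
  shows "set_integrable lborel {a..} (\<lambda>t. t powr (s - 1) * exp (- t))"
proof -
  define r where "r = max s 1"
  have r: "r > 0" "s \<le> r" by (auto simp: r_def)
  have "(\<lambda>t. t powr (r - 1) / exp t) integrable_on {0..}"
    using Gamma_integral_real[OF r(1)] by (auto simp: has_integral_integrable)
  then have "(\<lambda>t. t powr (r - 1) / exp t) absolutely_integrable_on {0..}"
    by (rule nonnegative_absolutely_integrable_1) auto
  then have "set_integrable lborel {0..} (\<lambda>t. t powr (r - 1) / exp t)"
    unfolding set_integrable_def by (subst (asm) integrable_completion) auto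
  then have "set_integrable lborel {a..} (\<lambda>t. t powr (r - 1) / exp t)"
    by (rule set_integrable_subset) (use a in auto)
  then have "set_integrable lborel {a..} (\<lambda>t. a powr (s - r) * (t powr (r - 1) / exp t))"
    by (intro set_integrable_mult_right) auto
  then show ?thesis
  proof (rule set_integrable_bound)
    show "AE t in lborel. t \<in> {a..} \<longrightarrow> norm (t powr (s - 1) * exp (- t))
        \<le> norm (a powr (s - r) * (t powr (r - 1) / exp t))"
    proof (intro AE_I2 impI)
      fix t assume t: "t \<in> {a..}"
      have "t powr (s - 1) = t powr (s - r) * t powr (r - 1)"
        by (simp flip: powr_add)
      moreover have "t powr (s - r) \<le> a powr (s - r)"
        using a t r by (intro powr_mono2') auto
      ultimately have "t powr (s - 1) \<le> a powr (s - r) * t powr (r - 1)"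
        by (simp add: mult_right_mono)
      then show "norm (t powr (s - 1) * exp (- t))
          \<le> norm (a powr (s - r) * (t powr (r - 1) / exp t))"
        by (simp add: exp_minus divide_simps)
    qed
  qed (auto simp: set_borel_measurable_def)
qed

text \<open>Moves the variable from the lower to the upper limit, where the results on integrals
  over \<open>{..x}\<close> apply. The indicator keeps the integrand away from 0, near which it need
  not be integrable.\<close>

lemma upper_inc_Gamma_split:
  fixes s a x :: real
  assumes "0 < a" "a \<le> x"
  shows "upper_inc_Gamma s x = upper_inc_Gamma s a
    - (LBINT t:{..x}. indicator {a..} t * (t powr (s - 1) * exp (- t)))"
proof -
  let ?h = "\<lambda>t. t powr (s - 1) * exp (- t)"
  have int: "set_integrable lborel {a..} ?h"
    using assms by (intro set_integrable_powr_exp_minus)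
  have "{a..} = {a..<x} \<union> {x..}" using assms by auto
  then have "(LBINT t:{a..}. ?h t) = (LBINT t:{a..<x}. ?h t) + (LBINT t:{x..}. ?h t)"
    by (simp only:) (intro set_integral_Un set_integrable_subset[OF int], use assms in auto)
  \<comment> \<open>The disjoint union forces a half-open interval; the missing point
    \<open>x\<close> is a null set.\<close>
  also have "(LBINT t:{a..<x}. ?h t) = (LBINT t:{a..x}. ?h t)"
  proof (rule set_integral_cong_set)
    show "AE t in lborel. t \<in> {a..x} \<longleftrightarrow> t \<in> {a..<x}"
      using AE_lborel_singleton[of x] by eventually_elim auto
  qed (simp_all add: set_borel_measurable_def)
  also have "\<dots> = (LBINT t:{..x}. indicator {a..} t * ?h t)"
    unfolding set_lebesgue_integral_def
    by (intro Bochner_Integration.integral_cong) (auto simp: indicator_def)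
  finally show ?thesis by (simp add: upper_inc_Gamma_def)
qed

lemma upper_inc_Gamma_has_real_derivative:
  fixes s x :: real
  assumes x: "0 < x"
  shows "(upper_inc_Gamma s has_real_derivative - (x powr (s - 1) * exp (- x))) (at x)"
proof -
  let ?h = "\<lambda>t. t powr (s - 1) * exp (- t)"
  obtain a where a: "0 < a" "a < x" using x dense by blast
  have "integrable lborel (\<lambda>t. indicator {a..} t * ?h t)"
    using set_integrable_powr_exp_minus[OF a(1), of s] by (simp add: set_integrable_def)
  moreover have "continuous_on {a<..<x+1} (\<lambda>t. indicator {a..} t * ?h t)"
  proof (subst continuous_on_cong)
    show "continuous_on {a<..<x+1} ?h"
      using a by (intro continuous_intros) auto
  qed auto
  ultimately have "((\<lambda>y. LBINT t:{..y}. indicator {a..} t * ?h t)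
      has_real_derivative indicator {a..} x * ?h x) (at x)"
    by (rule set_integral_atMost_has_real_derivative) (use a in auto)
  then have "((\<lambda>y. upper_inc_Gamma s a - (LBINT t:{..y}. indicator {a..} t * ?h t))
      has_real_derivative - ?h x) (at x)"
    using a by (auto intro!: derivative_eq_intros)
  then show ?thesis
    by (rule has_field_derivative_transform_within_open[where S="{a<..}"])
       (use a in \<open>auto intro: upper_inc_Gamma_split[symmetric]\<close>)
qed

lemma upper_inc_Gamma_tendsto_0: "(upper_inc_Gamma s \<longlongrightarrow> 0) at_top"
proof -
  let ?k = "\<lambda>t. indicator {1..} t * (t powr (s - 1) * exp (- t))"
  have int: "integrable lborel ?k"
    using set_integrable_powr_exp_minus[of 1 s] by (simp add: set_integrable_def)
  have "((\<lambda>y. LBINT t:{..y}. ?k t) \<longlongrightarrow> (\<integral>t. ?k t \<partial>lborel)) at_top"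
    using tendsto_integral_at_top[OF _ int] by (simp add: set_lebesgue_integral_def)
  then have "((\<lambda>y. upper_inc_Gamma s 1 - (LBINT t:{..y}. ?k t))
      \<longlongrightarrow> upper_inc_Gamma s 1 - (\<integral>t. ?k t \<partial>lborel)) at_top"
    by (intro tendsto_intros)
  moreover have "upper_inc_Gamma s 1 = (\<integral>t. ?k t \<partial>lborel)"
    by (simp add: upper_inc_Gamma_def set_lebesgue_integral_def)
  ultimately have "((\<lambda>y. upper_inc_Gamma s 1 - (LBINT t:{..y}. ?k t)) \<longlongrightarrow> 0) at_top"
    by simp
  moreover have "\<forall>\<^sub>F y in at_top. upper_inc_Gamma s 1 - (LBINT t:{..y}. ?k t) = upper_inc_Gamma s y"
    using eventually_ge_at_top[of 1]
    by eventually_elim (rule upper_inc_Gamma_split[symmetric], auto)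
  ultimately show ?thesis
    by (rule Lim_transform_eventually)
qed

text \<open>A function with negative derivative on the ray from \<open>x\<close> and limit 0 at
  infinity is positive at \<open>x\<close>.\<close>

lemma upper_inc_Gamma_pos:
  fixes s x :: real
  assumes x: "0 < x"
  shows "0 < upper_inc_Gamma s x"
proof (rule DERIV_neg_imp_decreasing_at_top[OF _ upper_inc_Gamma_tendsto_0])
  fix y assume "x \<le> y"
  then have "0 < y" using x by simp
  then show "\<exists>d. (upper_inc_Gamma s has_real_derivative d) (at y) \<and> d < 0"
    using upper_inc_Gamma_has_real_derivative[of y s] by (intro exI conjI) auto
qed

section \<open>Functions with vanishing derivative\<close>

text \<open>The constant is read off from a one-sided limit, which suits functions that are
  controlled only inside the open interval.\<close>

lemma DERIV_0_imp_const_lim: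
  fixes h :: "real \<Rightarrow> real"
  assumes der: "\<And>x. x \<in> {a<..<b} \<Longrightarrow> (h has_real_derivative 0) (at x)"
    and lim: "(h \<longlongrightarrow> l) (at_right a)" and x: "x \<in> {a<..<b}"
  shows "h x = l"
proof -
  have "\<exists>c. \<forall>y\<in>{a<..<b}. h y = c"
    by (intro has_field_derivative_zero_constant has_field_derivative_at_within[OF der]) auto
  then obtain c where c: "\<And>y. y \<in> {a<..<b} \<Longrightarrow> h y = c"
    by blast
  have "\<forall>\<^sub>F y in at_right a. h y = c"
    using x c by (auto simp: eventually_at_right_field intro!: exI[of _ b])
  then have "(h \<longlongrightarrow> c) (at_right a)"
    by (rule tendsto_eventually)
  with lim have "l = c"
    by (intro tendsto_unique[OF trivial_limit_at_right_real])
  with c x show ?thesis by simp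
qed

section \<open>The unit-Gompertz distribution and its partial first moment\<close>

context
  fixes \<alpha> \<beta> :: real
  assumes \<alpha>: "0 < \<alpha>" and \<beta>: "0 < \<beta>"
begin

definition gompertz_pdf :: "real \<Rightarrow> real" where
  "gompertz_pdf x = \<alpha> * \<beta> * exp (- \<alpha> * (1 / x powr \<beta> - 1)) / x powr (1 + \<beta>)"

definition gompertz_cdf :: "real \<Rightarrow> real" where
  "gompertz_cdf x = exp (- \<alpha> * (1 / x powr \<beta> - 1))"

text \<open>For u = \<alpha> / t^\<beta> one has t = (\<alpha> / u)^(1/\<beta>), and the density
  times dt becomes -exp(\<alpha>) exp(-u) du; this accounts for the prefactor and for the parameter
  1 - 1 / \<beta>. With the closed form as definition, its derivative and its limit at 0 stand in
  for a formal change of variables.\<close>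

definition gompertz_moment :: "real \<Rightarrow> real" where
  "gompertz_moment x =
    exp \<alpha> * \<alpha> powr (1 / \<beta>) * upper_inc_Gamma (1 - 1 / \<beta>) (\<alpha> / x powr \<beta>)"

lemma gompertz_pdf_pos: "0 < x \<Longrightarrow> 0 < gompertz_pdf x"
  using \<alpha> \<beta> by (simp add: gompertz_pdf_def)

lemma gompertz_moment_pos: "0 < x \<Longrightarrow> 0 < gompertz_moment x"
  using \<alpha> by (simp add: gompertz_moment_def upper_inc_Gamma_pos)

lemma scale_powr_has_real_derivative:
  assumes "0 < x"
  shows "((\<lambda>x. \<alpha> / x powr \<beta>) has_real_derivative - (\<alpha> * \<beta> / x powr (1 + \<beta>))) (at x)"
proof -
  have "((\<lambda>x. \<alpha> * x powr (- \<beta>)) has_real_derivative \<alpha> * (- \<beta> * x powr (- \<beta> - 1))) (at x)"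
    using assms by (intro DERIV_cmult has_real_derivative_powr)
  moreover have "- \<beta> - 1 = - (1 + \<beta>)"
    by simp
  then have "x powr (- \<beta> - 1) = 1 / x powr (1 + \<beta>)"
    by (simp only: powr_minus_divide)
  ultimately show ?thesis
    by (simp add: powr_minus_divide)
qed

lemma gompertz_cdf_has_real_derivative:
  assumes "0 < x"
  shows "(gompertz_cdf has_real_derivative gompertz_pdf x) (at x)"
proof -
  have "((\<lambda>x. exp (\<alpha> - \<alpha> / x powr \<beta>)) has_real_derivative
      exp (\<alpha> - \<alpha> / x powr \<beta>) * (0 - - (\<alpha> * \<beta> / x powr (1 + \<beta>)))) (at x)"
    using assms
    by (intro DERIV_chain2[OF DERIV_exp] DERIV_diff DERIV_const scale_powr_has_real_derivative)
  moreover have "(\<lambda>x. exp (\<alpha> - \<alpha> / x powr \<beta>)) = gompertz_cdf"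
    by (simp add: gompertz_cdf_def fun_eq_iff algebra_simps)
  moreover have "exp (\<alpha> - \<alpha> / x powr \<beta>) * (0 - - (\<alpha> * \<beta> / x powr (1 + \<beta>))) = gompertz_pdf x"
    by (simp add: gompertz_pdf_def algebra_simps)
  ultimately show ?thesis by simp
qed

lemma gompertz_moment_has_real_derivative:
  assumes x: "0 < x"
  shows "(gompertz_moment has_real_derivative x * gompertz_pdf x) (at x)"
proof -
  let ?s = "1 - 1 / \<beta>" and ?y = "\<alpha> / x powr \<beta>"
  have "(gompertz_moment has_real_derivative exp \<alpha> * \<alpha> powr (1 / \<beta>) *
      (- (?y powr (?s - 1) * exp (- ?y)) * - (\<alpha> * \<beta> / x powr (1 + \<beta>)))) (at x)"
    unfolding gompertz_moment_def using \<alpha> x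
    by (intro DERIV_cmult DERIV_chain2[OF upper_inc_Gamma_has_real_derivative]
        scale_powr_has_real_derivative) auto
  also have "exp \<alpha> * \<alpha> powr (1 / \<beta>) *
      (- (?y powr (?s - 1) * exp (- ?y)) * - (\<alpha> * \<beta> / x powr (1 + \<beta>))) =
      (\<alpha> powr (1 / \<beta>) * ?y powr (?s - 1)) * (\<alpha> * \<beta> * (exp \<alpha> * exp (- ?y)) / x powr (1 + \<beta>))"
    by simp
  \<comment> \<open>Here \<open>?s - 1\<close> is -1 / \<beta>, so the powers of \<alpha> cancel and
    \<open>x powr \<beta>\<close> is raised to 1 / \<beta>.\<close>
  also have "\<alpha> powr (1 / \<beta>) * ?y powr (?s - 1) = x"
    using \<alpha> \<beta> x by (simp add: powr_divide powr_powr powr_minus_divide)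
  also have "exp \<alpha> * exp (- ?y) = exp (- \<alpha> * (1 / x powr \<beta> - 1))"
    by (simp add: algebra_simps flip: exp_add)
  finally show ?thesis
    by (simp only: gompertz_pdf_def)
qed

lemma scale_powr_at_top: "filterlim (\<lambda>x. \<alpha> / x powr \<beta>) at_top (at_right 0)"
  using \<alpha> \<beta> by real_asymp

lemma gompertz_moment_tendsto_0: "(gompertz_moment \<longlongrightarrow> 0) (at_right 0)"
  unfolding gompertz_moment_def
  by (intro tendsto_mult_right_zero filterlim_compose[OF upper_inc_Gamma_tendsto_0 scale_powr_at_top])

lemma gompertz_cdf_tendsto_0: "(gompertz_cdf \<longlongrightarrow> 0) (at_right 0)"
  unfolding gompertz_cdf_def using \<alpha> \<beta> by real_asymp

lemma gompertz_cdf_tendsto_1: "(gompertz_cdf \<longlongrightarrow> 1) (at_left 1)"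
  using DERIV_isCont[OF gompertz_cdf_has_real_derivative[of 1]]
  by (auto simp: isCont_def gompertz_cdf_def intro: filterlim_mono[OF _ order_refl at_le])

text \<open>The right-hand side is the function \<open>g\<close> of the theorem, which from here on
  is handled only as a quotient.\<close>

lemma gompertz_moment_div_pdf:
  assumes "0 < x"
  shows "gompertz_moment x / gompertz_pdf x =
    \<alpha> powr (1 / \<beta>) / (\<alpha> * \<beta>) * exp (\<alpha> / x powr \<beta>) * x powr (1 + \<beta>)
        * upper_inc_Gamma (1 - 1 / \<beta>) (\<alpha> / x powr \<beta>)"
proof -
  have "exp (- \<alpha> * (1 / x powr \<beta> - 1)) = exp \<alpha> / exp (\<alpha> / x powr \<beta>)"
    by (simp add: algebra_simps flip: exp_diff)
  then show ?thesis
    using assms \<alpha> \<beta> by (simp add: gompertz_moment_def gompertz_pdf_def)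
qed

end

section \<open>Distribution functions of variables with a density\<close>

lemma (in prob_space) cdf_eq_set_integral_density:
  fixes X :: "'a \<Rightarrow> real"
  assumes dist: "distributed M lborel X (\<lambda>x. ennreal (f x))" and nonneg: "\<And>x. 0 \<le> f x"
  shows "cdf (distr M borel X) x = (LBINT t:{..x}. f t)"
proof -
  have X [measurable]: "random_variable borel X"
    using distributed_measurable[OF dist] by simp
  have "cdf (distr M borel X) x = prob (X -` {..x} \<inter> space M)"
    unfolding cdf_def by (simp add: measure_distr)
  also have "\<dots> = (\<integral>\<omega>. indicator (X -` {..x} \<inter> space M) \<omega> \<partial>M)"
    by simp
  also have "\<dots> = (\<integral>\<omega>. indicator {..x} (X \<omega>) \<partial>M)"
    by (intro Bochner_Integration.integral_cong) (auto simp: indicator_def)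
  also have "\<dots> = (\<integral>t. f t * indicator {..x} t \<partial>lborel)"
    using nonneg by (intro distributed_integral[OF dist, symmetric]) auto
  finally show ?thesis
    by (simp add: set_lebesgue_integral_def mult.commute)
qed

text \<open>A law with a density has no atoms. Continuity is what fixes the values of the
  distribution function at the end points of its support.\<close>

lemma (in prob_space) isCont_cdf_density:
  fixes X :: "'a \<Rightarrow> real"
  assumes dist: "distributed M lborel X f"
  shows "isCont (cdf (distr M borel X)) x"
proof -
  have X [measurable]: "random_variable borel X"
    using distributed_measurable[OF dist] by simp
  interpret D: real_distribution "distr M borel X"
    by simp
  have "emeasure (distr M borel X) {x} = emeasure M (X -` {x} \<inter> space M)"
    by (simp add: emeasure_distr)
  also have "\<dots> = (\<integral>\<^sup>+ t. f t * indicator {x} t \<partial>lborel)"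
    by (intro distributed_emeasure[OF dist]) auto
  also have "\<dots> = 0"
    using distributed_borel_measurable[OF dist]
    by (subst nn_integral_0_iff_AE) (use AE_lborel_singleton[of x] in \<open>auto simp: indicator_def\<close>)
  finally show ?thesis
    by (simp add: D.isCont_cdf measure_def)
qed

section \<open>The characterization by the conditional mean\<close>

theorem theorem2p3:
  fixes M :: "'a measure" and X :: "'a \<Rightarrow> real"
    and F f \<tau> g :: "real \<Rightarrow> real" and \<alpha> \<beta> :: real
  assumes "\<alpha> > 0" and "\<beta> > 0"
    and "prob_space M"
    and "F = cdf (distr M borel X)"
    and "\<And>x. 0 \<le> f x"
    and "distributed M lborel X (\<lambda>x. ennreal (f x))"
    and "integrable M X"
    and "Inf (ereal ` {x. F x > 0}) = 0"
    and "Sup (ereal ` {x. F x < 1}) = 1"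
    and "f differentiable_on {0<..<1}"
    and "\<And>x. x \<in> {0<..<1} \<Longrightarrow> \<tau> x = f x / F x"
    and "\<And>x. x \<in> {0<..<1} \<Longrightarrow> g x =
      \<alpha> powr (1 / \<beta>) / (\<alpha> * \<beta>) * exp (\<alpha> / x powr \<beta>) * x powr (1 + \<beta>)
        * upper_inc_Gamma (1 - 1 / \<beta>) (\<alpha> / x powr \<beta>)"
  shows "(\<forall>x\<in>{0<..<1}. cond_mean_le F f x = g x * \<tau> x) \<longleftrightarrow>
    (\<forall>x\<in>{0<..<1}. f x =
      \<alpha> * \<beta> * exp (- \<alpha> * (1 / x powr \<beta> - 1)) / x powr (1 + \<beta>))"
proof -
  interpret prob_space M by fact
  interpret D: real_distribution "distr M borel X"
    using distributed_measurable[OF assms(6)] by simp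
  note ab = assms(1,2)
  note nonneg = assms(5) and dist = assms(6)
  let ?p = "gompertz_pdf \<alpha> \<beta>" and ?P = "gompertz_cdf \<alpha> \<beta>" and ?K = "gompertz_moment \<alpha> \<beta>"
  define m where "m x = (LBINT t:{0..x}. t * f t)" for x
  have F_eq: "F x = (LBINT t:{..x}. f t)" for x
    using cdf_eq_set_integral_density[OF dist nonneg] assms(4) by simp
  have F_cont: "isCont F x" for x
    using isCont_cdf_density[OF dist] assms(4) by simp
  have F_mono: "x \<le> y \<Longrightarrow> F x \<le> F y" and F_nonneg: "0 \<le> F x" and F_le_1: "F x \<le> 1" for x y
    using D.cdf_nondecreasing D.cdf_nonneg D.cdf_bounded_prob assms(4) by auto
  have F_pos: "0 < F x" if "0 < x" for x
  proof -
    have "Inf (ereal ` {x. F x > 0}) < ereal x"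
      using assms(8) that by (simp add: zero_ereal_def)
    then obtain y where "0 < F y" "y < x"
      by (auto simp: Inf_less_iff)
    then show ?thesis using F_mono[of y x] by simp
  qed
  \<comment> \<open>The infimum determines \<open>F\<close> only strictly to the left of 0.
    Continuity carries the value 0 over to the point 0 and hence to the limit from the
    right.\<close>
  have "F x = 0" if "x < 0" for x
  proof (rule antisym[OF _ F_nonneg], rule ccontr)
    assume "\<not> F x \<le> 0"
    then have "Inf (ereal ` {x. F x > 0}) \<le> ereal x"
      by (intro Inf_lower) auto
    with assms(8) that show False by (simp add: zero_ereal_def)
  qed
  then have "\<forall>\<^sub>F x in at_left 0. F x = 0"
    by (auto simp: eventually_at_filter)
  then have "(F \<longlongrightarrow> 0) (at_left 0)"
    by (rule tendsto_eventually)
  moreover have "(F \<longlongrightarrow> F 0) (at_left 0)"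
    using F_cont[of 0] by (auto simp: isCont_def intro: filterlim_mono[OF _ order_refl at_le])
  ultimately have "F 0 = 0"
    using tendsto_unique trivial_limit_at_left_real by blast
  then have F_lim_0: "(F \<longlongrightarrow> 0) (at_right 0)"
    using F_cont[of 0] by (auto simp: isCont_def intro: filterlim_mono[OF _ order_refl at_le])
  \<comment> \<open>The mirror image at 1: the supremum gives the value to the right of 1, and
    continuity transports it to the limit from the left.\<close>
  have "F x = 1" if "1 < x" for x
  proof (rule antisym[OF F_le_1], rule ccontr)
    assume "\<not> 1 \<le> F x"
    then have "ereal x \<le> Sup (ereal ` {x. F x < 1})"
      by (intro Sup_upper) auto
    with assms(9) that show False by (simp add: one_ereal_def)
  qed
  then have "\<forall>\<^sub>F x in at_right 1. F x = 1"
    by (auto simp: eventually_at_filter)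
  then have "(F \<longlongrightarrow> 1) (at_right 1)"
    by (rule tendsto_eventually)
  moreover have "(F \<longlongrightarrow> F 1) (at_right 1)"
    using F_cont[of 1] by (auto simp: isCont_def intro: filterlim_mono[OF _ order_refl at_le])
  ultimately have "F 1 = 1"
    using tendsto_unique trivial_limit_at_right_real by blast
  then have F_lim_1: "(F \<longlongrightarrow> 1) (at_left 1)"
    using F_cont[of 1] by (auto simp: isCont_def intro: filterlim_mono[OF _ order_refl at_le])
  have f_cont: "continuous_on {0<..<1} f"
    using assms(10) by (rule differentiable_imp_continuous_on)
  have f_meas [measurable]: "f \<in> borel_measurable borel"
    using distributed_real_measurable[OF _ dist] nonneg by simp
  have f_int: "integrable lborel f"
    using distributed_integrable[OF dist, of "\<lambda>_. 1"] nonneg by simp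
  have F_deriv: "(F has_real_derivative f x) (at x)" if "x \<in> {0<..<1}" for x
    using set_integral_atMost_has_real_derivative[OF f_int f_cont that]
    by (simp flip: F_eq)
  \<comment> \<open>Cutting off at 0 and 1 makes the integrand bounded by \<open>f\<close>, hence
    integrable on the whole line, and leaves \<open>m\<close> unchanged on the open unit
    interval.\<close>
  let ?k = "\<lambda>t. indicator {0..1} t * (t * f t)"
  have k_int: "integrable lborel ?k"
    using f_int
    by (rule Bochner_Integration.integrable_bound)
       (use nonneg in \<open>auto simp: indicator_def abs_mult intro!: mult_left_le_one_le\<close>)
  have m_eq: "m x = (LBINT t:{..x}. ?k t)" if "x \<in> {0<..<1}" for x
    unfolding m_def set_lebesgue_integral_def using that
    by (intro Bochner_Integration.integral_cong) (auto simp: indicator_def)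
  have m_deriv: "(m has_real_derivative x * f x) (at x)" if x: "x \<in> {0<..<1}" for x
  proof -
    have "continuous_on {0<..<1} (\<lambda>t. t * f t)"
      by (intro continuous_intros f_cont)
    then have "continuous_on {0<..<1} ?k"
      by (subst continuous_on_cong[OF refl, of _ _ "\<lambda>t. t * f t"]) auto
    from set_integral_atMost_has_real_derivative[OF k_int this x]
    have "((\<lambda>y. LBINT t:{..y}. ?k t) has_real_derivative x * f x) (at x)"
      using x by simp
    then show ?thesis
      by (rule has_field_derivative_transform_within_open[where S="{0<..<1}"])
         (use x m_eq in auto)
  qed
  \<comment> \<open>Since the factor \<open>t\<close> is at most 1 where \<open>?k\<close> lives,
    \<open>m\<close> is squeezed between 0 and \<open>F\<close>.\<close>
  have m_lim: "(m \<longlongrightarrow> 0) (at_right 0)"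
  proof (rule tendsto_sandwich[OF _ _ tendsto_const F_lim_0])
    have "0 \<le> m x" for x
      unfolding m_def set_lebesgue_integral_def
      using nonneg by (intro Bochner_Integration.integral_nonneg) (auto simp: indicator_def)
    then show "\<forall>\<^sub>F x in at_right 0. 0 \<le> m x"
      by simp
    have "m x \<le> F x" if x: "x \<in> {0<..<1}" for x
      unfolding m_eq[OF x] F_eq
    proof (rule set_integral_mono)
      show "set_integrable lborel {..x} ?k" "set_integrable lborel {..x} f"
        unfolding set_integrable_def
        by (intro integrable_mult_indicator k_int f_int; simp)+
      show "?k t \<le> f t" if "t \<in> {..x}" for t
        using nonneg[of t] by (auto simp: indicator_def mult_left_le_one_le)
    qed
    then show "\<forall>\<^sub>F x in at_right 0. m x \<le> F x"
      by (auto simp: eventually_at_right_field intro!: exI[of _ 1])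
  qed
  have g_eq: "g x = ?K x / ?p x" if "x \<in> {0<..<1}" for x
    using assms(12)[OF that] gompertz_moment_div_pdf[OF ab, of x] that by simp
  \<comment> \<open>Both sides of the identity carry the factor 1 / \<open>F x\<close>, which
    cancels because \<open>F x\<close> is positive; clearing the denominator \<open>?p x\<close>
    leaves a relation free of \<open>F\<close>.\<close>
  have cond_iff: "cond_mean_le F f x = g x * \<tau> x \<longleftrightarrow> m x * ?p x = ?K x * f x"
    if x: "x \<in> {0<..<1}" for x
    using F_pos[of x] gompertz_pdf_pos[OF ab, of x] x
    unfolding cond_mean_le_def g_eq[OF x] assms(11)[OF x] m_def[symmetric]
    by (auto simp: field_simps)
  have "(\<forall>x\<in>{0<..<1}. cond_mean_le F f x = g x * \<tau> x) \<longleftrightarrow> (\<forall>x\<in>{0<..<1}. f x = ?p x)"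
  proof (intro iffI ballI)
    fix x :: real
    assume *: "\<forall>x\<in>{0<..<1}. f x = ?p x" and x: "x \<in> {0<..<1}"
    have "m x - ?K x = 0"
    proof (rule DERIV_0_imp_const_lim[OF _ _ x])
      show "((\<lambda>x. m x - ?K x) \<longlongrightarrow> 0) (at_right 0)"
        using tendsto_diff[OF m_lim gompertz_moment_tendsto_0[OF ab]] by simp
      show "((\<lambda>x. m x - ?K x) has_real_derivative 0) (at y)" if "y \<in> {0<..<1}" for y
        using DERIV_diff[OF m_deriv[OF that] gompertz_moment_has_real_derivative[OF ab]] * that
        by simp
    qed
    then show "cond_mean_le F f x = g x * \<tau> x"
      using cond_iff[OF x] * x by simp
  next
    fix x :: real
    assume "\<forall>x\<in>{0<..<1}. cond_mean_le F f x = g x * \<tau> x" and x: "x \<in> {0<..<1}"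
    then have eq: "m x * ?p x = ?K x * f x" if "x \<in> {0<..<1}" for x
      using cond_iff that by auto
    have "\<exists>c. \<forall>x\<in>{0<..<1}. m x / ?K x = c"
    proof (rule has_field_derivative_zero_constant)
      fix y :: real assume y: "y \<in> {0<..<1}"
      have "((\<lambda>x. m x / ?K x) has_real_derivative
          (y * f y * ?K y - m y * (y * ?p y)) / (?K y * ?K y)) (at y)"
        using y gompertz_moment_pos[OF ab, of y]
        by (intro DERIV_divide m_deriv gompertz_moment_has_real_derivative ab) auto
      \<comment> \<open>The numerator of the quotient rule is \<open>y\<close> times the difference
        of the two sides of \<open>eq\<close>.\<close>
      moreover have "y * f y * ?K y - m y * (y * ?p y) = 0"
        using eq[OF y] by (simp add: algebra_simps)
      ultimately show "((\<lambda>x. m x / ?K x) has_real_derivative 0) (at y within {0<..<1})"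
        by (simp add: has_field_derivative_at_within)
    qed simp
    then obtain c where c: "\<And>x. x \<in> {0<..<1} \<Longrightarrow> m x / ?K x = c"
      by blast
    have f_eq: "f x = c * ?p x" if "x \<in> {0<..<1}" for x
      using eq[OF that] c[OF that] gompertz_moment_pos[OF ab, of x] that by (auto simp: field_simps)
    \<comment> \<open>The limit at 0 vanishes for every value of \<open>c\<close>, so this alone
      does not determine \<open>c\<close>.\<close>
    have F_c: "F x - c * ?P x = 0" if x: "x \<in> {0<..<1}" for x
    proof (rule DERIV_0_imp_const_lim[OF _ _ x])
      show "((\<lambda>x. F x - c * ?P x) \<longlongrightarrow> 0) (at_right 0)"
        using tendsto_diff[OF F_lim_0 tendsto_mult_left[OF gompertz_cdf_tendsto_0[OF ab]]] by simp
      show "((\<lambda>x. F x - c * ?P x) has_real_derivative 0) (at y)" if "y \<in> {0<..<1}" for y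
        using DERIV_diff[OF F_deriv[OF that] DERIV_cmult[where c = c, OF gompertz_cdf_has_real_derivative[OF ab]]]
          f_eq that by simp
    qed
    \<comment> \<open>Normalization enters here: both distribution functions tend to 1, so the limit
      1 - \<open>c\<close> of a function that is identically 0 must be 0.\<close>
    have "((\<lambda>x. F x - c * ?P x) \<longlongrightarrow> 1 - c * 1) (at_left 1)"
      by (intro tendsto_intros F_lim_1 gompertz_cdf_tendsto_1 ab)
    moreover have "\<forall>\<^sub>F x in at_left 1. F x - c * ?P x = 0"
      using F_c by (auto simp: eventually_at_left_field intro!: exI[of _ 0])
    then have "((\<lambda>x. F x - c * ?P x) \<longlongrightarrow> 0) (at_left 1)"
      by (rule tendsto_eventually)
    ultimately have "1 - c * 1 = 0"
      using tendsto_unique trivial_limit_at_left_real by blast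
    with f_eq[OF x] show "f x = ?p x" by simp
  qed
  then show ?thesis
    by (simp add: gompertz_pdf_def[OF ab])
qed

end
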